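(* Let $d\ge2$. For each $\alpha>0$ there exists $p'(\alpha)\in(p_c(d),1)$ such that for every $p\in(p'(\alpha),1]$, \[ \limsup_{\|x\|_1\to+\infty,\ x\in\mathbb{Z}^d}\frac{\ln\mathbb{P}_p\big(0\leftrightarrow x,\ D(0,x)\ge(1+\alpha)\|x\|_1\big)}{\|x\|_1}<0. \]
   Context: Bernoulli bond percolation on $\mathbb{Z}^d$: $\mathbb{E}^d$ is the set of edges between points of $\mathbb{Z}^d$ at Euclidean distance $1$; $\mathbb{P}_p=(p\delta_1+(1-p)\delta_0)^{\otimes\mathbb{E}^d}$ on $\{0,1\}^{\mathbb{E}^d}$, an edge $e$ being open if $\omega(e)=1$. $p_c(d)$ is the critical probability of bond percolation on $\mathbb{Z}^d$. A path is a sequence of successive nearest neighbours; its length is its number of edges; it is open if all its edges are open. $x\leftrightarrow y$ means that $x$ and $y$ are joined by an open path. The chemical distance $D(x,y)$ is the minimal length of an open path from $x$ to $y$ ($+\infty$ if none). $\|x\|_1=\sum_i|x_i|$. *)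

theory Defs
  imports "HOL-Probability.Probability"
begin

text \<open>Sites of Z^d are vectors int ^ 'd (d = CARD('d)).\<close>

definition norm1 :: "int ^ 'd \<Rightarrow> int" where
  "norm1 x = (\<Sum>i\<in>UNIV. \<bar>x $ i\<bar>)"

text \<open>The edge set E^d: unordered pairs of sites at Euclidean (equivalently l1) distance 1.\<close>
definition bonds :: "(int ^ 'd) set set" where
  "bonds = {{x, y} | x y. norm1 (x - y) = 1}"

definition open_path :: "((int ^ 'd) set \<Rightarrow> bool) \<Rightarrow> (int ^ 'd) list \<Rightarrow> bool" where
  "open_path \<omega> xs \<longleftrightarrow> xs \<noteq> [] \<and> successively (\<lambda>a b. norm1 (b - a) = 1 \<and> \<omega> {a, b}) xs"

definition connected :: "((int ^ 'd) set \<Rightarrow> bool) \<Rightarrow> int ^ 'd \<Rightarrow> int ^ 'd \<Rightarrow> bool" where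
  "connected \<omega> x y \<longleftrightarrow> (\<exists>xs. open_path \<omega> xs \<and> hd xs = x \<and> last xs = y)"

text \<open>Chemical distance: minimal number of edges of an open path; +infinity if none.\<close>
definition chem_dist :: "((int ^ 'd) set \<Rightarrow> bool) \<Rightarrow> int ^ 'd \<Rightarrow> int ^ 'd \<Rightarrow> ereal" where
  "chem_dist \<omega> x y = Inf {ereal (real (length xs - 1)) | xs. open_path \<omega> xs \<and> hd xs = x \<and> last xs = y}"

definition perc :: "real \<Rightarrow> ((int ^ 'd) set \<Rightarrow> bool) measure" where
  "perc p = (\<Pi>\<^sub>M e\<in>bonds. measure_pmf (bernoulli_pmf p))"

definition theta :: "('d::finite) itself \<Rightarrow> real \<Rightarrow> real" where
  "theta _ p = measure (perc p :: ((int ^ 'd) set \<Rightarrow> bool) measure)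
      {\<omega> \<in> space (perc p). infinite {y. connected \<omega> 0 y}}"

definition p_c :: "('d::finite) itself \<Rightarrow> real" where
  "p_c d = Sup {p \<in> {0..1}. theta d p = 0}"

definition lnE :: "real \<Rightarrow> ereal" where
  "lnE t = (if t = 0 then - \<infinity> else ereal (ln t))"

end

theory Submission
  imports Defs
begin

text \<open>
  Call two edges near if they have endpoints at distance at most 1, and let \<open>T\<close> be the union of the
  near-connected clusters of closed edges that meet a fixed geodesic \<open>\<gamma>\<close> of \<open>Z^d\<close> from 0 to \<open>x\<close>.

  For \<open>k < D(0,x)\<close> let \<open>B\<close> be the ball of radius \<open>k\<close> for the chemical distance. Some open edge of the
  boundary of \<open>B\<close> lies on \<open>\<gamma>\<close> or is near \<open>T\<close>. Otherwise the increments of the indicator of \<open>B\<close>,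
  restricted to \<open>T\<close>, sum to zero around each unit square, hence are the increments of a function \<open>g\<close>
  on \<open>Z^d\<close>; then \<open>g(x) - g(0) = -1\<close> along \<open>\<gamma>\<close>, but \<open>g(x) = g(0)\<close> along an open path. An open edge
  is in the boundary of the ball of radius \<open>k\<close> for at most one \<open>k\<close>, so \<open>D(0,x) \<le> |x| + c |T|\<close>.
  Thus \<open>D(0,x) \<ge> (1 + \<alpha>) |x|\<close> forces \<open>|T| \<ge> \<alpha> |x| / c\<close>, which for \<open>p\<close> close to 1 is exponentially
  unlikely by counting the lattice walks that cover \<open>\<gamma>\<close> and edges of \<open>T\<close>.

  The same potential argument with two coordinate half-axes shows that a finite cluster of the origin
  forces a closed cluster joining the two half-axes; this gives \<open>p_c < 1\<close>.
\<close>


section \<open>Closed 1-forms on the lattice\<close>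

lemma int_antidifference:
  fixes \<phi> :: "int \<Rightarrow> 'a::ab_group_add"
  shows "\<exists>S. S 0 = 0 \<and> (\<forall>t. S (t + 1) = S t + \<phi> t)"
proof -
  define S where "S t = (if t \<ge> 0 then sum \<phi> {0..<t} else - sum \<phi> {t..<0})" for t
  have "S 0 = 0" by (simp add: S_def)
  moreover have "S (t + 1) = S t + \<phi> t" for t
  proof (cases "t \<ge> 0")
    case True
    then have "{0..<t+1} = insert t {0..<t}" by auto
    then show ?thesis using True by (simp add: S_def add.commute)
  next
    case False
    then have "{t..<0} = insert t {t+1..<0}" by auto
    then have "sum \<phi> {t..<0} = \<phi> t + sum \<phi> {t+1..<0}" by simp
    then show ?thesis using False by (cases "t = -1") (auto simp: S_def)
  qed
  ultimately show ?thesis by blast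
qed

definition unit_vec :: "'d \<Rightarrow> int ^ 'd" where
  "unit_vec i = axis i 1"

lemma unit_vec_nth: "unit_vec i $ j = (if j = i then 1 else 0)"
  by (simp add: unit_vec_def axis_def)

text \<open>Discrete Poincare lemma, by induction on the set of directions: keep the potential for
  \<open>I\<close> on the hyperplane where coordinate \<open>j\<close> is 0 and extend it off this
  hyperplane by summing \<open>F j\<close> along lines in direction \<open>j\<close>.\<close>

lemma closed_one_form_exact_on:
  fixes F :: "'d::finite \<Rightarrow> int ^ 'd \<Rightarrow> 'a::ab_group_add"
  assumes closed: "\<And>i j a. i \<noteq> j \<Longrightarrow>
      F i a + F j (a + unit_vec i) = F j a + F i (a + unit_vec j)"
  shows "\<exists>g. \<forall>i\<in>I. \<forall>a. g (a + unit_vec i) = g a + F i a"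
proof (induction I rule: finite_induct[OF finite])
  case 1
  then show ?case by simp
next
  case (2 j I)
  then obtain g where g: "\<And>i a. i \<in> I \<Longrightarrow> g (a + unit_vec i) = g a + F i a" by blast
  define pt where "pt a t = (\<chi> i. if i = j then t else a $ i)" for a :: "int ^ 'd" and t :: int
  have pt_self: "pt a (a $ j) = a" for a
    by (simp add: pt_def vec_eq_iff)
  have pt_Suc: "pt a (t + 1) = pt a t + unit_vec j" for a t
    by (simp add: pt_def vec_eq_iff unit_vec_nth)
  have pt_j: "pt (a + unit_vec j) t = pt a t" for a t
    by (simp add: pt_def vec_eq_iff unit_vec_nth)
  have pt_other: "pt (a + unit_vec i) t = pt a t + unit_vec i" if "i \<noteq> j" for a t i
    using that by (simp add: pt_def vec_eq_iff unit_vec_nth)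
  have "\<exists>S. S 0 = 0 \<and> (\<forall>t. S (t + 1) = S t + F j (pt a t))" for a
    by (rule int_antidifference)
  then obtain S where S0: "\<And>a. S a 0 = 0"
    and S1: "\<And>a t. S a (t + 1) = S a t + F j (pt a t)" by metis
  \<comment> \<open>Stokes on a strip of unit squares between heights 0 and \<open>t\<close>; each
    induction step adds one square and uses \<open>closed\<close> once.\<close>
  have S_eq: "S (a + unit_vec i) t + F i (pt a 0) = S a t + F i (pt a t)" if i: "i \<noteq> j" for a i t
  proof (induction t rule: int_induct[where k = 0])
    case base
    then show ?case by (simp add: S0)
  next
    case (step1 t)
    have "S (a + unit_vec i) (t + 1) + F i (pt a 0)
        = (S (a + unit_vec i) t + F i (pt a 0)) + F j (pt a t + unit_vec i)"
      by (simp add: S1 pt_other i)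
    also have "\<dots> = S a t + (F i (pt a t) + F j (pt a t + unit_vec i))"
      using step1 by (simp add: add.assoc)
    also have "\<dots> = S a (t + 1) + F i (pt a (t + 1))"
      using closed[OF i, of "pt a t"] by (simp add: S1 pt_Suc add.assoc)
    finally show ?case .
  next
    case (step2 t)
    define s where "s = t - 1"
    have t: "t = s + 1" by (simp add: s_def)
    have "S (a + unit_vec i) (s + 1) + F i (pt a 0)
        = (S (a + unit_vec i) s + F i (pt a 0)) + F j (pt a s + unit_vec i)"
      by (simp add: S1 pt_other i)
    moreover have "S a (s + 1) + F i (pt a (s + 1))
        = (S a s + F i (pt a s)) + F j (pt a s + unit_vec i)"
      using closed[OF i, of "pt a s"] by (simp add: S1 pt_Suc add.assoc)
    ultimately show ?case
      using step2 by (simp add: t)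
  qed
  define g' where "g' a = g (pt a 0) + S a (a $ j)" for a
  \<comment> \<open>\<open>S\<close> was chosen separately for each base point; the recursion forces
    equal values for base points on the same line in direction \<open>j\<close>.\<close>
  have Sj: "S (a + unit_vec j) t = S a t" for a t
  proof (induction t rule: int_induct[where k = 0])
    case (step2 t)
    then show ?case using S1[of _ "t - 1"] by (simp add: pt_j)
  qed (simp_all add: S0 S1 pt_j)
  have "g' (a + unit_vec j) = g' a + F j a" for a
    by (simp add: g'_def pt_j Sj unit_vec_nth S1 pt_self add.assoc)
  moreover have "g' (a + unit_vec i) = g' a + F i a" if "i \<in> I" for i a
  proof -
    have ij: "i \<noteq> j" using that 2 by auto
    have "g' (a + unit_vec i) = g (pt a 0) + (S (a + unit_vec i) (a $ j) + F i (pt a 0))"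
      using ij by (simp add: g'_def pt_other g[OF that] unit_vec_nth)
    also have "\<dots> = g' a + F i a"
      by (simp add: S_eq[OF ij] g'_def pt_self add.assoc)
    finally show ?thesis .
  qed
  ultimately show ?case by (intro exI[of _ g']) auto
qed

section \<open>The l1 norm and nearest neighbours\<close>

lemma norm1_ge_0: "0 \<le> norm1 x"
  by (simp add: norm1_def sum_nonneg)

lemma norm1_minus_commute: "norm1 (x - y) = norm1 (y - x)"
  by (simp add: norm1_def abs_minus_commute)

lemma norm1_0 [simp]: "norm1 0 = 0"
  by (simp add: norm1_def)

lemma norm1_unit_vec [simp]: "norm1 (unit_vec i) = 1"
  by (simp add: norm1_def unit_vec_nth if_distrib[of abs] cong: if_cong)

lemma abs_nth_le_norm1: "\<bar>x $ i\<bar> \<le> norm1 x"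
  unfolding norm1_def by (rule member_le_sum) auto

lemma norm1_add_le: "norm1 (x + y) \<le> norm1 x + norm1 y"
  unfolding norm1_def sum.distrib[symmetric] by (rule sum_mono) auto

text \<open>Move a nonzero coordinate one step towards 0. This yields both the classification of
  neighbours and the geodesics.\<close>

lemma norm1_reduce:
  fixes x :: "int ^ 'd::finite"
  assumes "x \<noteq> 0"
  obtains i s where "s = 1 \<or> s = -1" "norm1 (x - s *s unit_vec i) = norm1 x - 1"
proof -
  obtain i where i: "x $ i \<noteq> 0" using assms by (auto simp: vec_eq_iff)
  have eq: "norm1 y = \<bar>y $ i\<bar> + (\<Sum>j\<in>UNIV - {i}. \<bar>y $ j\<bar>)" for y :: "int ^ 'd"
    unfolding norm1_def by (rule sum.remove) auto
  have "norm1 (x - sgn (x $ i) *s unit_vec i) = norm1 x - 1"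
    using i unfolding eq by (auto simp: unit_vec_nth sgn_if)
  moreover have "sgn (x $ i) = 1 \<or> sgn (x $ i) = -1" using i by (auto simp: sgn_if)
  ultimately show ?thesis using that by blast
qed

lemma norm1_eq_0: "norm1 x = 0 \<Longrightarrow> x = 0"
  by (simp add: norm1_def sum_nonneg_eq_0_iff vec_eq_iff)

lemma neighbour_cases:
  fixes a b :: "int ^ 'd::finite"
  assumes "norm1 (b - a) = 1"
  obtains i where "b = a + unit_vec i" | i where "a = b + unit_vec i"
proof -
  have "b - a \<noteq> 0" using assms by auto
  then obtain i s where s: "s = 1 \<or> s = (-1::int)" and n: "norm1 (b - a - s *s unit_vec i) = norm1 (b - a) - 1"
    using norm1_reduce by metis
  have "b - a - s *s unit_vec i = 0" using n assms norm1_eq_0[of "b - a - s *s unit_vec i"] by linarith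
  then have ba: "b $ j = a $ j + s * unit_vec i $ j" for j
    by (simp add: vec_eq_iff algebra_simps)
  from s show ?thesis
  proof
    assume "s = 1" then show ?thesis using ba by (intro that(1)[of i]) (simp add: vec_eq_iff)
  next
    assume "s = -1" then show ?thesis using ba by (intro that(2)[of i]) (simp add: vec_eq_iff)
  qed
qed

text \<open>Distance 1 is allowed, and not only a common endpoint, so that any two edges of a unit
  square are near, opposite sides included.\<close>

definition near :: "(int ^ 'd) set \<Rightarrow> (int ^ 'd) set \<Rightarrow> bool" where
  "near e f \<longleftrightarrow> (\<exists>u\<in>e. \<exists>v\<in>f. norm1 (v - u) \<le> 1)"

definition edge_boundary :: "(int ^ 'd) set \<Rightarrow> (int ^ 'd) set set" where
  "edge_boundary B = {{a, b} | a b. norm1 (b - a) = 1 \<and> a \<in> B \<and> b \<notin> B}"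

lemma edge_boundary_iff:
  assumes "norm1 (b - a) = 1"
  shows "{a, b} \<in> edge_boundary B \<longleftrightarrow> (a \<in> B) \<noteq> (b \<in> B)"
  using assms norm1_minus_commute[of a b]
  by (auto simp: edge_boundary_def doubleton_eq_iff)

lemma edge_boundary_subset_bonds: "edge_boundary B \<subseteq> bonds"
  unfolding edge_boundary_def bonds_def using norm1_minus_commute by fastforce

lemma bondsI: "norm1 (b - a) = 1 \<Longrightarrow> {a, b} \<in> bonds"
  unfolding bonds_def using norm1_minus_commute by fastforce

text \<open>On each unit square the increments of the indicator of \<open>B\<close> are either all kept or all
  dropped, so the restriction of this 1-form to \<open>T\<close> is still closed.\<close>

lemma potential_of_cut_part:
  fixes B :: "(int ^ 'd::finite) set" and T :: "(int ^ 'd) set set"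
  assumes stable: "\<And>e f. e \<in> T \<Longrightarrow> e \<in> edge_boundary B \<Longrightarrow> f \<in> edge_boundary B \<Longrightarrow> near e f \<Longrightarrow> f \<in> T"
  obtains g :: "int ^ 'd \<Rightarrow> int" where
    "\<And>a b. norm1 (b - a) = 1 \<Longrightarrow>
       g b - g a = (if {a, b} \<in> T then of_bool (b \<in> B) - of_bool (a \<in> B) else 0)"
proof -
  define w :: "int ^ 'd \<Rightarrow> int ^ 'd \<Rightarrow> int"
    where "w a b = (if {a, b} \<in> T then of_bool (b \<in> B) - of_bool (a \<in> B) else 0)" for a b
  have nontriv: "{a, b} \<in> edge_boundary B" if "norm1 (b - a) = 1" "of_bool (b \<in> B) - of_bool (a \<in> B) \<noteq> (0::int)" for a b
    using that by (auto simp: edge_boundary_iff of_bool_def split: if_splits)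
  have "w a (a + unit_vec i) + w (a + unit_vec i) (a + unit_vec i + unit_vec j)
      = w a (a + unit_vec j) + w (a + unit_vec j) (a + unit_vec j + unit_vec i)"
    if "i \<noteq> j" for a i j
  proof -
    define b c d where "b = a + unit_vec i" and "c = a + unit_vec j" and "d = a + unit_vec i + unit_vec j"
    have n: "norm1 (b - a) = 1" "norm1 (c - a) = 1" "norm1 (d - b) = 1" "norm1 (d - c) = 1"
      "norm1 (a - b) = 1" "norm1 (a - c) = 1" "norm1 (b - d) = 1" "norm1 (c - d) = 1"
      unfolding norm1_minus_commute[of a] norm1_minus_commute[of _ d] by (simp_all add: b_def c_def d_def)
    define Q where "Q = {{a,b},{b,d},{a,c},{c,d}}"
    have nearQ: "near e f" if "e \<in> Q" "f \<in> Q" for e f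
      using that n unfolding Q_def near_def by auto
    have "w a b + w b d = w a c + w c d"
    proof (cases "\<exists>e\<in>Q. e \<in> T \<and> e \<in> edge_boundary B")
      case True
      then have allT: "f \<in> T" if "f \<in> Q" "f \<in> edge_boundary B" for f
        using stable nearQ that by blast
      have "w u v = of_bool (v \<in> B) - of_bool (u \<in> B)" if "{u,v} \<in> Q" "norm1 (v - u) = 1" for u v
        using allT[OF that(1)] nontriv[OF that(2)] unfolding w_def by (cases "{u, v} \<in> T") fastforce+
      then have "w a b = of_bool (b \<in> B) - of_bool (a \<in> B)" "w b d = of_bool (d \<in> B) - of_bool (b \<in> B)"
        "w a c = of_bool (c \<in> B) - of_bool (a \<in> B)" "w c d = of_bool (d \<in> B) - of_bool (c \<in> B)"
        using n by (auto simp: Q_def)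
      then show ?thesis by simp
    next
      case False
      have "w u v = 0" if "{u,v} \<in> Q" "norm1 (v - u) = 1" for u v
      proof -
        have "{u, v} \<notin> T \<or> of_bool (v \<in> B) - of_bool (u \<in> B) = (0::int)"
          using False that(1) nontriv[OF that(2)] by blast
        then show ?thesis unfolding w_def by presburger
      qed
      then have "w a b = 0" "w b d = 0" "w a c = 0" "w c d = 0"
        using n by (auto simp: Q_def)
      then show ?thesis by simp
    qed
    then show ?thesis by (simp add: b_def c_def d_def ac_simps)
  qed
  then obtain g where g: "\<And>i a. g (a + unit_vec i) = g a + w a (a + unit_vec i)"
    using closed_one_form_exact_on[where F = "\<lambda>i a. w a (a + unit_vec i)" and I = UNIV] by auto
  \<comment> \<open>The 1-form given to the Poincare lemma records steps in positive directions
    only; antisymmetry covers the reversed ones.\<close>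
  have w_anti: "w b a = - w a b" for a b
    by (simp add: w_def insert_commute)
  show ?thesis
  proof (rule that[of g])
    fix a b :: "int ^ 'd"
    assume "norm1 (b - a) = 1"
    then have "g b - g a = w a b"
      by (cases rule: neighbour_cases) (auto simp: g w_anti[of _ b])
    then show "g b - g a = (if {a, b} \<in> T then of_bool (b \<in> B) - of_bool (a \<in> B) else 0)"
      by (simp add: w_def)
  qed
qed

section \<open>Paths and closed clusters\<close>

fun path_edges :: "'a list \<Rightarrow> 'a set set" where
  "path_edges (a # b # xs) = insert {a, b} (path_edges (b # xs))"
| "path_edges _ = {}"

lemma path_edges_append: "path_edges (us @ v # vs) = path_edges (us @ [v]) \<union> path_edges (v # vs)"
  by (induction us rule: path_edges.induct) auto

lemma finite_path_edges [simp]: "finite (path_edges xs)"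
  by (induction xs rule: path_edges.induct) auto

lemma card_path_edges: "card (path_edges xs) \<le> length xs - 1"
proof (induction xs rule: path_edges.induct)
  case (1 a b xs)
  then show ?case
    using card_insert_le_m1[of "Suc (length xs)" "path_edges (b # xs)" "{a, b}"] by simp
qed auto

lemma path_edges_subset_set: "e \<in> path_edges xs \<Longrightarrow> e \<subseteq> set xs"
  by (induction xs rule: path_edges.induct) auto

lemma successively_path_edges:
  "successively P xs \<Longrightarrow> successively (\<lambda>a b. P a b \<and> {a, b} \<in> path_edges xs) xs"
proof (induction xs rule: path_edges.induct)
  case (1 a b xs)
  then have "successively (\<lambda>c d. P c d \<and> {c, d} \<in> path_edges (b # xs)) (b # xs)" by simp
  then have "successively (\<lambda>c d. P c d \<and> {c, d} \<in> path_edges (a # b # xs)) (b # xs)"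
    by (rule successively_mono) auto
  then show ?case using 1 by simp
qed auto

lemma successively_const:
  assumes "successively (\<lambda>a b. h a = h b) xs" "xs \<noteq> []"
  shows "h (hd xs) = h (last xs)"
  using assms by (induction xs rule: path_edges.induct) auto

text \<open>Induction on the norm: append \<open>x\<close> to a geodesic that ends at a neighbour of
  \<open>x\<close> closer to 0.\<close>

lemma path_exists:
  fixes x :: "int ^ 'd::finite"
  shows "\<exists>xs. xs \<noteq> [] \<and> hd xs = 0 \<and> last xs = x \<and> length xs = nat (norm1 x) + 1 \<and>
    successively (\<lambda>a b. norm1 (b - a) = 1) xs"
proof (induction "nat (norm1 x)" arbitrary: x)
  case 0
  then have "x = 0" using norm1_ge_0[of x] norm1_eq_0 by fastforce
  then show ?case by (intro exI[of _ "[0]"]) simp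
next
  case (Suc n)
  then have "x \<noteq> 0" by auto
  then obtain i s where s: "s = 1 \<or> s = (-1::int)" and n: "norm1 (x - s *s unit_vec i) = norm1 x - 1"
    using norm1_reduce by metis
  define y where "y = x - s *s unit_vec i"
  have "n = nat (norm1 y)" using Suc(2) n by (simp add: y_def)
  from Suc(1)[OF this] obtain xs where xs: "xs \<noteq> []" "hd xs = 0" "last xs = y"
    "length xs = nat (norm1 y) + 1" "successively (\<lambda>a b. norm1 (b - a) = 1) xs" by blast
  have "x - y = s *s unit_vec i" by (simp add: y_def)
  then have "norm1 (x - y) = norm1 (unit_vec i)"
    using s unfolding norm1_def by auto
  then have "norm1 (x - y) = 1" by simp
  then have "successively (\<lambda>a b. norm1 (b - a) = 1) (xs @ [x])"
    using xs by (simp add: successively_append_iff)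
  then show ?case using xs Suc(2) \<open>n = nat (norm1 y)\<close>
    by (intro exI[of _ "xs @ [x]"]) auto
qed

text \<open>The union of those components, in the graph of closed bonds with adjacency
  \<open>near\<close>, that contain a bond of \<open>E\<close>. Open members of \<open>E\<close>
  start nothing.\<close>

inductive_set closed_cluster :: "((int ^ 'd) set \<Rightarrow> bool) \<Rightarrow> (int ^ 'd) set set \<Rightarrow> (int ^ 'd) set set"
  for \<omega> E where
  base: "e \<in> E \<Longrightarrow> e \<in> bonds \<Longrightarrow> \<not> \<omega> e \<Longrightarrow> e \<in> closed_cluster \<omega> E"
| step: "e \<in> closed_cluster \<omega> E \<Longrightarrow> f \<in> bonds \<Longrightarrow> \<not> \<omega> f \<Longrightarrow> near e f \<Longrightarrow> f \<in> closed_cluster \<omega> E"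

lemma closed_clusterD: "e \<in> closed_cluster \<omega> E \<Longrightarrow> e \<in> bonds \<and> \<not> \<omega> e"
  by (erule closed_cluster.cases) auto

text \<open>A derivation starts from a single seed. This reduces a cluster that meets a half-axis to
  the cluster of one edge of that half-axis.\<close>

lemma closed_cluster_Union: "closed_cluster \<omega> (\<Union>k\<in>K. E k) = (\<Union>k\<in>K. closed_cluster \<omega> (E k))"
proof (intro equalityI subsetI)
  fix e assume "e \<in> closed_cluster \<omega> (\<Union>k\<in>K. E k)"
  then show "e \<in> (\<Union>k\<in>K. closed_cluster \<omega> (E k))"
    by induction (auto intro: closed_cluster.intros)
next
  fix e assume "e \<in> (\<Union>k\<in>K. closed_cluster \<omega> (E k))"
  then obtain k where k: "k \<in> K" and e: "e \<in> closed_cluster \<omega> (E k)" by blast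
  from e show "e \<in> closed_cluster \<omega> (\<Union>k\<in>K. E k)"
    by induction (use k in \<open>auto intro: closed_cluster.intros\<close>)
qed

lemma finite_norm1_ball: "finite {u :: int ^ 'd::finite. norm1 u \<le> n}"
proof (rule finite_subset)
  show "{u :: int ^ 'd. norm1 u \<le> n} \<subseteq> vec_lambda ` (PiE UNIV (\<lambda>_. {-n..n}))"
  proof
    fix u :: "int ^ 'd" assume "u \<in> {u. norm1 u \<le> n}"
    then have "u $ i \<in> {-n..n}" for i
      using abs_nth_le_norm1[of u i] by auto
    then show "u \<in> vec_lambda ` (PiE UNIV (\<lambda>_. {-n..n}))"
      by (intro image_eqI[of _ _ "vec_nth u"]) (simp_all add: PiE_def)
  qed
qed (auto intro!: finite_PiE)

text \<open>0 and the 2d signed unit vectors. The cardinality, 2d + 1, is the branching number in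
  all the counts below.\<close>

definition unit_steps :: "(int ^ 'd) set" where
  "unit_steps = {u. norm1 u \<le> 1}"

lemma finite_unit_steps [simp]: "finite (unit_steps :: (int ^ 'd::finite) set)"
  unfolding unit_steps_def by (rule finite_norm1_ball)

lemma card_unit_steps_pos: "card (unit_steps :: (int ^ 'd::finite) set) > 0"
proof -
  have "(0 :: int ^ 'd) \<in> unit_steps" by (simp add: unit_steps_def)
  then show ?thesis by (auto simp: card_gt_0_iff)
qed

lemma bonds_other_end:
  assumes "f \<in> bonds" "v \<in> f"
  obtains w where "f = {v, w}" "norm1 (w - v) = 1"
proof -
  obtain a b where ab: "f = {a, b}" "norm1 (a - b) = 1" using assms by (auto simp: bonds_def)
  have "norm1 (b - a) = 1" using ab norm1_minus_commute by metis
  then show ?thesis using that ab assms(2) by (cases "v = a") auto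
qed

text \<open>A bond near \<open>e\<close> is determined by an endpoint of \<open>e\<close>, a step to
  one of its own endpoints, and a step to the other one. The bound is the constant relating the
  excess of the chemical distance to the size of the closed cluster.\<close>

lemma near_bonds_bound:
  fixes e :: "(int ^ 'd::finite) set"
  assumes "e \<in> bonds"
  shows "finite {f \<in> bonds. near e f}"
    "card {f \<in> bonds. near e f} \<le> 2 * card (unit_steps :: (int ^ 'd) set) ^ 2"
proof -
  let ?U = "unit_steps :: (int ^ 'd) set"
  let ?h = "\<lambda>(u, s, t). {u + s, u + s + t :: int ^ 'd}"
  have fin: "finite e" and card: "card e \<le> 2"
    using assms by (auto simp: bonds_def card_insert_if)
  have sub: "{f \<in> bonds. near e f} \<subseteq> ?h ` (e \<times> ?U \<times> ?U)"
  proof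
    fix f assume "f \<in> {f \<in> bonds. near e f}"
    then obtain u v where f: "f \<in> bonds" and uv: "u \<in> e" "v \<in> f" "norm1 (v - u) \<le> 1"
      by (auto simp: near_def)
    obtain w where w: "f = {v, w}" "norm1 (w - v) = 1" using bonds_other_end f uv(2) by metis
    have "f = ?h (u, v - u, w - v)" using w by simp
    then show "f \<in> ?h ` (e \<times> ?U \<times> ?U)"
      using uv w by (intro image_eqI[of _ _ "(u, v - u, w - v)"]) (auto simp: unit_steps_def)
  qed
  have fin': "finite (e \<times> ?U \<times> ?U)" using fin by simp
  then show "finite {f \<in> bonds. near e f}" using sub finite_surj by blast
  have "card {f \<in> bonds. near e f} \<le> card (e \<times> ?U \<times> ?U)"
    using surj_card_le[OF fin' sub] .
  also have "\<dots> = card e * card ?U ^ 2" by (simp add: card_cartesian_product power2_eq_square)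
  also have "\<dots> \<le> 2 * card ?U ^ 2" using card by simp
  finally show "card {f \<in> bonds. near e f} \<le> 2 * card ?U ^ 2" .
qed

section \<open>Balls for the chemical distance\<close>

definition chem_ball :: "((int ^ 'd) set \<Rightarrow> bool) \<Rightarrow> nat \<Rightarrow> (int ^ 'd) set" where
  "chem_ball \<omega> k = {y. \<exists>xs. open_path \<omega> xs \<and> hd xs = 0 \<and> last xs = y \<and> length xs \<le> k + 1}"

lemma chem_ball_mono: "k \<le> l \<Longrightarrow> chem_ball \<omega> k \<subseteq> chem_ball \<omega> l"
  by (force simp: chem_ball_def)

lemma chem_ball_step:
  assumes "a \<in> chem_ball \<omega> k" "norm1 (b - a) = 1" "\<omega> {a, b}"
  shows "b \<in> chem_ball \<omega> (Suc k)"
proof -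
  obtain xs where "open_path \<omega> xs" "hd xs = 0" "last xs = a" "length xs \<le> k + 1"
    using assms by (auto simp: chem_ball_def)
  then show ?thesis using assms
    unfolding chem_ball_def
    by (intro CollectI exI[of _ "xs @ [b]"])
      (auto simp: open_path_def successively_append_iff)
qed

text \<open>An open edge leaving the ball of radius \<open>k\<close> ends in the ball of radius
  \<open>k + 1\<close>, so every larger ball contains both its endpoints.\<close>

lemma open_edge_boundary_chem_ball_unique:
  assumes "e \<in> edge_boundary (chem_ball \<omega> k)" "e \<in> edge_boundary (chem_ball \<omega> l)" "\<omega> e"
  shows "k = l"
proof -
  have False if "k < l" "e \<in> edge_boundary (chem_ball \<omega> k)" "e \<in> edge_boundary (chem_ball \<omega> l)" for k l
  proof -
    obtain a b where ab: "e = {a, b}" "norm1 (b - a) = 1" "a \<in> chem_ball \<omega> k" "b \<notin> chem_ball \<omega> k"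
      using \<open>e \<in> edge_boundary (chem_ball \<omega> k)\<close> by (auto simp: edge_boundary_def)
    have "b \<in> chem_ball \<omega> (Suc k)" using chem_ball_step ab assms(3) by blast
    then have "b \<in> chem_ball \<omega> l" "a \<in> chem_ball \<omega> l"
      using chem_ball_mono[of "Suc k" l \<omega>] chem_ball_mono[of k l \<omega>] that(1) ab by auto
    then show False using that(3) ab edge_boundary_iff by blast
  qed
  then show ?thesis using assms by (metis linorder_neqE_nat)
qed

lemma open_boundary_edge_near_closed_cluster:
  fixes \<omega> :: "(int ^ 'd::finite) set \<Rightarrow> bool"
  assumes path: "\<gamma> \<noteq> []" "successively (\<lambda>a b. norm1 (b - a) = 1) \<gamma>" "hd \<gamma> = y" "last \<gamma> = x"
    and conn: "connected \<omega> y x" and B: "y \<in> B" "x \<notin> B"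
  defines "T \<equiv> closed_cluster \<omega> (path_edges \<gamma>)"
  shows "\<exists>f\<in>edge_boundary B. \<omega> f \<and> (f \<in> path_edges \<gamma> \<or> (\<exists>e\<in>T. near e f))"
proof (rule ccontr)
  assume contr: "\<not> ?thesis"
  then have no: "\<not> \<omega> f" if "f \<in> edge_boundary B" "f \<in> path_edges \<gamma> \<or> (\<exists>e\<in>T. near e f)" for f
    using that contr by blast
  \<comment> \<open>By the assumption to be refuted, boundary edges near \<open>T\<close> are
    closed, hence absorbed by the cluster.\<close>
  have stable: "f \<in> T" if "e \<in> T" "f \<in> edge_boundary B" "near e f" for e f
    using that no[of f] edge_boundary_subset_bonds
    unfolding T_def by (auto intro: closed_cluster.step)
  obtain g :: "int ^ 'd \<Rightarrow> int" where g: "\<And>a b. norm1 (b - a) = 1 \<Longrightarrow>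
       g b - g a = (if {a, b} \<in> T then of_bool (b \<in> B) - of_bool (a \<in> B) else 0)"
    using potential_of_cut_part[of T B] stable by metis
  \<comment> \<open>Boundary edges on \<open>\<gamma>\<close> are closed, hence seeds of
    \<open>T\<close>; so along \<open>\<gamma>\<close> the potential changes exactly as the
    indicator of \<open>B\<close> does.\<close>
  have "successively (\<lambda>a b. g a - of_bool (a \<in> B) = g b - of_bool (b \<in> B)) \<gamma>"
  proof (rule successively_mono[OF successively_path_edges[OF path(2)]])
    fix a b assume ab: "norm1 (b - a) = 1 \<and> {a, b} \<in> path_edges \<gamma>"
    show "g a - of_bool (a \<in> B) = g b - of_bool (b \<in> B)"
    proof (cases "{a, b} \<in> edge_boundary B")
      case True
      then have "{a, b} \<in> T"
        using no[OF True] ab bondsI unfolding T_def by (auto intro: closed_cluster.base)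
      then show ?thesis using g[of b a] ab by simp
    next
      case False
      then have "(a \<in> B) = (b \<in> B)" using edge_boundary_iff ab by blast
      then show ?thesis using g[of b a] ab by (simp split: if_splits)
    qed
  qed
  then have 1: "g y - 1 = g x"
    using successively_const[where h = "\<lambda>a. g a - of_bool (a \<in> B)" and xs = \<gamma>] path B by simp
  obtain xs where xs: "open_path \<omega> xs" "hd xs = y" "last xs = x"
    using conn by (auto simp: connected_def)
  \<comment> \<open>Edges of \<open>T\<close> are closed, so \<open>g\<close> is constant along an
    open path.\<close>
  have "successively (\<lambda>a b. norm1 (b - a) = 1 \<and> \<omega> {a, b}) xs" using xs by (simp add: open_path_def)
  then have "successively (\<lambda>a b. g a = g b) xs"
  proof (rule successively_mono)
    fix a b assume ab: "norm1 (b - a) = 1 \<and> \<omega> {a, b}"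
    then have "{a, b} \<notin> T" using closed_clusterD unfolding T_def by blast
    then show "g a = g b" using g[of b a] ab by simp
  qed
  then have "g y = g x" using successively_const[of g xs] xs by (auto simp: open_path_def)
  then show False using 1 by simp
qed

text \<open>Each radius \<open>k < N\<close> supplies an open boundary edge on
  \<open>\<gamma>\<close> or near the cluster. These edges are distinct, so \<open>N\<close> is at
  most the number of candidates. The distance enters as a lower bound \<open>N\<close> on path
  lengths, which keeps the counting in the naturals.\<close>

lemma chem_dist_le_closed_cluster:
  fixes \<omega> :: "(int ^ 'd::finite) set \<Rightarrow> bool"
  assumes path: "\<gamma> \<noteq> []" "successively (\<lambda>a b. norm1 (b - a) = 1) \<gamma>" "hd \<gamma> = 0" "last \<gamma> = x"
    and conn: "connected \<omega> 0 x"
    and dist: "\<And>xs. open_path \<omega> xs \<Longrightarrow> hd xs = 0 \<Longrightarrow> last xs = x \<Longrightarrow> N \<le> length xs - 1"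
    and fin: "finite (closed_cluster \<omega> (path_edges \<gamma>))"
  shows "N \<le> (length \<gamma> - 1) + 2 * card (unit_steps :: (int ^ 'd) set) ^ 2 * card (closed_cluster \<omega> (path_edges \<gamma>))"
proof -
  define T where "T = closed_cluster \<omega> (path_edges \<gamma>)"
  let ?c = "2 * card (unit_steps :: (int ^ 'd) set) ^ 2"
  define A where "A = path_edges \<gamma> \<union> (\<Union>e\<in>T. {f \<in> bonds. near e f})"
  have "\<exists>f. f \<in> edge_boundary (chem_ball \<omega> k) \<and> \<omega> f \<and> f \<in> A" if "k < N" for k
  proof -
    have "0 \<in> chem_ball \<omega> k" unfolding chem_ball_def
      by (intro CollectI exI[of _ "[0]"]) (simp add: open_path_def)
    moreover have "x \<notin> chem_ball \<omega> k" using dist that by (fastforce simp: chem_ball_def)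
    ultimately obtain f where f: "f \<in> edge_boundary (chem_ball \<omega> k)" "\<omega> f"
      "f \<in> path_edges \<gamma> \<or> (\<exists>e\<in>T. near e f)"
      using open_boundary_edge_near_closed_cluster[OF path conn] unfolding T_def by blast
    moreover have "f \<in> bonds" using f(1) edge_boundary_subset_bonds by blast
    ultimately show ?thesis unfolding A_def by blast
  qed
  then obtain e where e: "\<And>k. k < N \<Longrightarrow> e k \<in> edge_boundary (chem_ball \<omega> k) \<and> \<omega> (e k) \<and> e k \<in> A"
    by metis
  have "inj_on e {..<N}"
  proof (rule inj_onI)
    fix k l assume kl: "k \<in> {..<N}" "l \<in> {..<N}" "e k = e l"
    show "k = l"
      by (rule open_edge_boundary_chem_ball_unique[of "e k" \<omega>])
        (use kl e[of k] e[of l] in auto)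
  qed
  have Tb: "e \<in> bonds" if "e \<in> T" for e using that closed_clusterD unfolding T_def by blast
  have "finite A" unfolding A_def using fin near_bonds_bound(1) Tb by (auto simp: T_def)
  have "N = card (e ` {..<N})" using \<open>inj_on e {..<N}\<close> by (simp add: card_image)
  also have "\<dots> \<le> card A" using e \<open>finite A\<close> by (intro card_mono) auto
  also have "\<dots> \<le> card (path_edges \<gamma>) + card (\<Union>e\<in>T. {f \<in> bonds. near e f})"
    unfolding A_def by (rule card_Un_le)
  also have "card (\<Union>e\<in>T. {f \<in> bonds. near e f}) \<le> (\<Sum>e\<in>T. card {f \<in> bonds. near e f})"
    using fin by (intro card_UN_le) (simp add: T_def)
  also have "\<dots> \<le> (\<Sum>e\<in>T. ?c)" using near_bonds_bound(2) Tb by (intro sum_mono) blast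
  also have "\<dots> = ?c * card T" by simp
  finally show ?thesis using card_path_edges[of \<gamma>] by (simp add: T_def)
qed

section \<open>Walks covering closed clusters\<close>

text \<open>Zero steps are allowed because in an excursion \<open>v, a, b, a, v\<close> the sites
  \<open>a\<close> and \<open>v\<close> may coincide; every excursion then costs exactly 4
  steps.\<close>

definition lazy_walk :: "(int ^ 'd) list \<Rightarrow> bool" where
  "lazy_walk ws \<longleftrightarrow> ws \<noteq> [] \<and> successively (\<lambda>a b. norm1 (b - a) \<le> 1) ws"

text \<open>A finite certificate suited to a union bound: \<open>L\<close> steps and
  \<open>m\<close> distinct closed bonds among those traversed. Since a zero step puts a singleton
  into \<open>path_edges\<close>, \<open>S \<subseteq> bonds\<close> is required separately.\<close>

definition closed_along_walk :: "((int ^ 'd) set \<Rightarrow> bool) \<Rightarrow> int ^ 'd \<Rightarrow> nat \<Rightarrow> nat \<Rightarrow> bool" where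
  "closed_along_walk \<omega> v L m \<longleftrightarrow> (\<exists>ws S. lazy_walk ws \<and> hd ws = v \<and> length ws = Suc L \<and>
     S \<subseteq> path_edges ws \<and> S \<subseteq> bonds \<and> card S = m \<and> (\<forall>e\<in>S. \<not> \<omega> e))"

text \<open>The walk starts as \<open>\<gamma>\<close>; each further edge \<open>{a, b}\<close> of the cluster is attached to a visited
  site \<open>v\<close> by the excursion \<open>v, a, b, a, v\<close>.\<close>

lemma closed_cluster_covering_walk:
  fixes \<omega> :: "(int ^ 'd::finite) set \<Rightarrow> bool"
  assumes \<gamma>: "lazy_walk \<gamma>"
    and T: "infinite (closed_cluster \<omega> (path_edges \<gamma>)) \<or> m \<le> card (closed_cluster \<omega> (path_edges \<gamma>))"
  shows "\<exists>S ws. S \<subseteq> closed_cluster \<omega> (path_edges \<gamma>) \<and> finite S \<and> card S = m \<and> lazy_walk ws \<and>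
    hd ws = hd \<gamma> \<and> length ws = length \<gamma> + 4 * m \<and> set \<gamma> \<subseteq> set ws \<and> S \<subseteq> path_edges ws"
  using T
proof (induction m)
  case 0
  show ?case by (intro exI[of _ "{}"] exI[of _ \<gamma>]) (simp add: \<gamma>)
next
  case (Suc m)
  define T where "T = closed_cluster \<omega> (path_edges \<gamma>)"
  have "infinite T \<or> m \<le> card T" using Suc.prems by (auto simp: T_def)
  then obtain S ws where S: "S \<subseteq> T" "finite S" "card S = m" and ws: "lazy_walk ws"
    "hd ws = hd \<gamma>" "length ws = length \<gamma> + 4 * m" "set \<gamma> \<subseteq> set ws" "S \<subseteq> path_edges ws"
    using Suc.IH unfolding T_def by blast
  \<comment> \<open>\<open>S\<close> has \<open>m\<close> elements, while \<open>T\<close> is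
    infinite or has at least \<open>m + 1\<close>.\<close>
  have "\<not> T \<subseteq> S"
  proof
    assume "T \<subseteq> S"
    then have "T = S" using S by blast
    then show False using Suc.prems S by (simp add: T_def)
  qed
  \<comment> \<open>Otherwise \<open>S\<close> exhausts the cluster, by induction: a seed has its
    endpoints on \<open>\<gamma>\<close>, and a bond near a member of \<open>S\<close> has an
    endpoint within distance 1 of a visited site.\<close>
  have "\<exists>e\<in>T - S. \<exists>v\<in>set ws. \<exists>a\<in>e. norm1 (a - v) \<le> 1"
  proof (rule ccontr)
    assume no: "\<not> ?thesis"
    have "e \<in> S" if "e \<in> closed_cluster \<omega> (path_edges \<gamma>)" for e
      using that
    proof induction
      case (base e)
      then have "e \<in> T" by (auto simp: T_def intro: closed_cluster.base)
      obtain a where "a \<in> e" using base(2) by (auto simp: bonds_def)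
      moreover have "a \<in> set ws" using path_edges_subset_set[OF base(1)] ws(4) \<open>a \<in> e\<close> by blast
      moreover have "norm1 (a - a) \<le> 1" by simp
      ultimately show ?case using no \<open>e \<in> T\<close> by blast
    next
      case (step e f)
      then have "f \<in> T" by (auto simp: T_def intro: closed_cluster.step)
      moreover have "e \<subseteq> set ws" using step.IH ws(5) path_edges_subset_set by blast
      ultimately show ?case using no \<open>near e f\<close> unfolding near_def by blast
    qed
    then show False using \<open>\<not> T \<subseteq> S\<close> unfolding T_def by blast
  qed
  then obtain e v a where e: "e \<in> T" "e \<notin> S" "v \<in> set ws" "a \<in> e" "norm1 (a - v) \<le> 1" by blast
  have "e \<in> bonds" using e(1) closed_clusterD by (auto simp: T_def)
  then obtain b where b: "e = {a, b}" "norm1 (b - a) = 1" using bonds_other_end e(4) by metis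
  obtain us vs where uv: "ws = us @ v # vs" using split_list[OF e(3)] by blast
  define ws' where "ws' = us @ v # a # b # a # v # vs"
  have pe: "path_edges ws' = path_edges (us @ [v]) \<union> path_edges (v # a # b # a # v # vs)"
    unfolding ws'_def by (rule path_edges_append)
  have "path_edges ws \<subseteq> path_edges ws'"
    unfolding pe unfolding uv by (subst path_edges_append) auto
  moreover have "e \<in> path_edges ws'" unfolding pe b by simp
  ultimately have "insert e S \<subseteq> path_edges ws'" using ws(5) by blast
  moreover have "lazy_walk ws'"
    using ws(1) b(2) e(5) norm1_minus_commute[of a b] norm1_minus_commute[of a v]
    unfolding lazy_walk_def ws'_def uv
    by (auto simp: successively_append_iff successively_Cons)
  moreover have "hd ws' = hd \<gamma>" using ws(2) unfolding ws'_def uv by (cases us) auto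
  moreover have "length ws' = length \<gamma> + 4 * Suc m" using ws(3) unfolding ws'_def uv by simp
  moreover have "set \<gamma> \<subseteq> set ws'" using ws(4) unfolding ws'_def uv by auto
  moreover have "insert e S \<subseteq> T" "finite (insert e S)" "card (insert e S) = Suc m" using S e by auto
  ultimately show ?case unfolding T_def by blast
qed

lemma closed_cluster_closed_along_walk:
  fixes \<omega> :: "(int ^ 'd::finite) set \<Rightarrow> bool"
  assumes \<gamma>: "lazy_walk \<gamma>"
    and T: "infinite (closed_cluster \<omega> (path_edges \<gamma>)) \<or> m \<le> card (closed_cluster \<omega> (path_edges \<gamma>))"
  shows "closed_along_walk \<omega> (hd \<gamma>) (length \<gamma> - 1 + 4 * m) m"
proof -
  obtain S ws where S: "S \<subseteq> closed_cluster \<omega> (path_edges \<gamma>)" "card S = m" "lazy_walk ws"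
    "hd ws = hd \<gamma>" "length ws = length \<gamma> + 4 * m" "S \<subseteq> path_edges ws"
    using closed_cluster_covering_walk[OF assms] by blast
  have "length ws = Suc (length \<gamma> - 1 + 4 * m)"
    using S(5) \<gamma> by (cases \<gamma>) (auto simp: lazy_walk_def)
  moreover have "S \<subseteq> bonds" "\<forall>e\<in>S. \<not> \<omega> e" using S(1) closed_clusterD by blast+
  ultimately show ?thesis unfolding closed_along_walk_def using S by blast
qed

text \<open>Each of the \<open>L\<close> steps is chosen from \<open>unit_steps\<close>.\<close>

lemma lazy_walks_bound:
  fixes v :: "int ^ 'd::finite"
  shows "finite {ws. lazy_walk ws \<and> hd ws = v \<and> length ws = Suc L} \<and>
    card {ws. lazy_walk ws \<and> hd ws = v \<and> length ws = Suc L} \<le> card (unit_steps :: (int ^ 'd) set) ^ L"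
proof (induction L arbitrary: v)
  case 0
  have "{ws. lazy_walk ws \<and> hd ws = v \<and> length ws = Suc 0} \<subseteq> {[v]}"
    by (auto simp: length_Suc_conv)
  then show ?case using card_mono[of "{[v]}"] by (auto intro: finite_subset)
next
  case (Suc L)
  define W where "W v L = {ws. lazy_walk ws \<and> hd ws = v \<and> length ws = Suc L}" for v :: "int ^ 'd" and L
  let ?U = "unit_steps :: (int ^ 'd) set"
  have IH: "finite (W v L)" "card (W v L) \<le> card ?U ^ L" for v using Suc.IH by (auto simp: W_def)
  have sub: "W v (Suc L) \<subseteq> (\<Union>u\<in>?U. (#) v ` W (v + u) L)"
  proof
    fix ws assume "ws \<in> W v (Suc L)"
    then obtain b xs where ws: "ws = v # b # xs" "lazy_walk ws" "length xs = L"
      by (auto simp: W_def length_Suc_conv)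
    have "b - v \<in> ?U" "b # xs \<in> W (v + (b - v)) L"
      using ws by (auto simp: W_def lazy_walk_def unit_steps_def)
    then show "ws \<in> (\<Union>u\<in>?U. (#) v ` W (v + u) L)" using ws(1) by blast
  qed
  have fin: "finite (\<Union>u\<in>?U. (#) v ` W (v + u) L)" using IH by auto
  have "card (W v (Suc L)) \<le> card (\<Union>u\<in>?U. (#) v ` W (v + u) L)"
    using sub fin by (rule card_mono[rotated])
  also have "\<dots> \<le> (\<Sum>u\<in>?U. card ((#) v ` W (v + u) L))" by (rule card_UN_le) simp
  also have "\<dots> \<le> (\<Sum>u\<in>?U. card ?U ^ L)"
    by (intro sum_mono) (use IH card_image_le le_trans in blast)
  also have "\<dots> = card ?U ^ Suc L" by simp
  finally show ?case using finite_subset[OF sub fin] by (simp add: W_def)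
qed

section \<open>Probabilities of closed bonds along walks\<close>

lemma prob_space_perc: "prob_space (perc p)"
  unfolding perc_def by (intro prob_space_PiM measure_pmf.prob_space_axioms)

lemma perc_component_measurable:
  assumes "e \<in> bonds"
  shows "{\<omega> \<in> space (perc p). \<omega> e} \<in> sets (perc p)" "{\<omega> \<in> space (perc p). \<not> \<omega> e} \<in> sets (perc p)"
proof -
  have *: "(\<lambda>\<omega>. \<omega> e) \<in> perc p \<rightarrow>\<^sub>M measure_pmf (bernoulli_pmf p)"
    unfolding perc_def by (rule measurable_component_singleton[OF assms])
  have "(\<lambda>\<omega>. \<omega> e) -` {b} \<inter> space (perc p) \<in> sets (perc p)" for b
    by (rule measurable_sets[OF *]) simp
  from this[of True] this[of False]
  show "{\<omega> \<in> space (perc p). \<omega> e} \<in> sets (perc p)" "{\<omega> \<in> space (perc p). \<not> \<omega> e} \<in> sets (perc p)"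
    by (simp_all add: vimage_def Int_def conj_commute)
qed

lemma perc_all_eq:
  fixes S :: "(int ^ 'd) set set"
  assumes "finite S" "S \<subseteq> bonds"
  shows "{\<omega> \<in> space (perc p). \<forall>e\<in>S. \<omega> e = b} \<in> sets (perc p)"
    "measure (perc p) {\<omega> \<in> space (perc p). \<forall>e\<in>S. \<omega> e = b} = pmf (bernoulli_pmf p) b ^ card S"
proof -
  have "{\<omega> \<in> space (perc p). \<omega> e = b} \<in> sets (perc p)" if "e \<in> S" for e
    using perc_component_measurable[of e p] that assms by (cases b) auto
  then show "{\<omega> \<in> space (perc p). \<forall>e\<in>S. \<omega> e = b} \<in> sets (perc p)"
    by (rule sets.sets_Collect_finite_All[OF _ assms(1)])
  interpret product_prob_space "\<lambda>_. measure_pmf (bernoulli_pmf p)" "bonds :: (int ^ 'd) set set"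
    by unfold_locales
  have "emeasure (perc p) {\<omega> \<in> space (perc p). \<forall>e\<in>S. \<omega> e \<in> {b}} =
      (\<Prod>e\<in>S. emeasure (measure_pmf (bernoulli_pmf p)) {b})"
    unfolding perc_def by (rule emeasure_PiM_Collect) (use assms in auto)
  also have "\<dots> = ennreal (pmf (bernoulli_pmf p) b ^ card S)"
    by (simp add: emeasure_pmf_single ennreal_power)
  finally show "measure (perc p) {\<omega> \<in> space (perc p). \<forall>e\<in>S. \<omega> e = b} = pmf (bernoulli_pmf p) b ^ card S"
    by (simp add: measure_def)
qed

text \<open>Union bound over pairs of a walk and a set of its edges: with q the number of unit steps
  there are at most \<open>q ^ L\<close> walks, each has at most \<open>2 ^ L\<close> edge sets, and
  \<open>m\<close> given bonds are all closed with probability \<open>(1 - p) ^ m\<close>.\<close>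

lemma measure_closed_along_walk:
  fixes v :: "int ^ 'd::finite"
  assumes p: "0 \<le> p" "p \<le> 1"
  shows "{\<omega> \<in> space (perc p). closed_along_walk \<omega> v L m} \<in> sets (perc p)"
    "measure (perc p) {\<omega> \<in> space (perc p). closed_along_walk \<omega> v L m}
      \<le> (2 * real (card (unit_steps :: (int ^ 'd) set))) ^ L * (1 - p) ^ m"
proof -
  let ?q = "card (unit_steps :: (int ^ 'd) set)"
  interpret prob_space "perc p :: ((int ^ 'd) set \<Rightarrow> bool) measure" by (rule prob_space_perc)
  define W where "W = {ws. lazy_walk ws \<and> hd ws = v \<and> length ws = Suc L}"
  define I where "I = Sigma W (\<lambda>ws. {S \<in> Pow (path_edges ws). S \<subseteq> bonds \<and> card S = m})"
  define A where "A i = {\<omega> \<in> space (perc p). \<forall>e\<in>snd i. \<omega> e = False}"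
    for i :: "(int ^ 'd) list \<times> (int ^ 'd) set set"
  have W: "finite W" "card W \<le> ?q ^ L" using lazy_walks_bound[of v L] by (auto simp: W_def)
  have finI: "finite I" unfolding I_def using W(1) by auto
  have "card I = (\<Sum>ws\<in>W. card {S \<in> Pow (path_edges ws). S \<subseteq> bonds \<and> card S = m})"
    unfolding I_def using W(1) by (intro card_SigmaI) auto
  also have "\<dots> \<le> (\<Sum>ws\<in>W. 2 ^ L)"
  proof (rule sum_mono)
    fix ws assume "ws \<in> W"
    have "card {S \<in> Pow (path_edges ws). S \<subseteq> bonds \<and> card S = m} \<le> card (Pow (path_edges ws))"
      by (rule card_mono) auto
    also have "\<dots> = 2 ^ card (path_edges ws)" by (simp add: card_Pow)
    also have "\<dots> \<le> 2 ^ L" using card_path_edges[of ws] \<open>ws \<in> W\<close>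
      by (intro power_increasing) (auto simp: W_def)
    finally show "card {S \<in> Pow (path_edges ws). S \<subseteq> bonds \<and> card S = m} \<le> 2 ^ L" .
  qed
  also have "\<dots> \<le> ?q ^ L * 2 ^ L" using W(2) by simp
  finally have cardI: "card I \<le> (2 * ?q) ^ L" by (simp add: power_mult_distrib mult.commute)
  have AI: "A i \<in> sets (perc p)" "prob (A i) = (1 - p) ^ m" if "i \<in> I" for i
  proof -
    have "finite (snd i)" "snd i \<subseteq> bonds" "card (snd i) = m"
      using that finite_subset[OF _ finite_path_edges] by (auto simp: I_def)
    then show "A i \<in> sets (perc p)" "prob (A i) = (1 - p) ^ m"
      using perc_all_eq[of "snd i" p False] p by (simp_all add: A_def)
  qed
  have eq: "{\<omega> \<in> space (perc p). closed_along_walk \<omega> v L m} = (\<Union>i\<in>I. A i)"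
    unfolding closed_along_walk_def A_def I_def W_def by fastforce
  show "{\<omega> \<in> space (perc p). closed_along_walk \<omega> v L m} \<in> sets (perc p)"
    unfolding eq using finI AI by auto
  have "prob (\<Union>i\<in>I. A i) \<le> (\<Sum>i\<in>I. prob (A i))"
    using finI AI by (intro finite_measure_subadditive_finite) auto
  also have "\<dots> = real (card I) * (1 - p) ^ m" using AI by simp
  also have "\<dots> \<le> real ((2 * ?q) ^ L) * (1 - p) ^ m"
    using p cardI by (intro mult_right_mono) (simp_all only: of_nat_le_iff, simp)
  finally show "prob {\<omega> \<in> space (perc p). closed_along_walk \<omega> v L m} \<le> (2 * real ?q) ^ L * (1 - p) ^ m"
    unfolding eq by simp
qed

section \<open>Infinite open clusters\<close>

lemma connected_self: "connected \<omega> x x"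
  unfolding connected_def by (intro exI[of _ "[x]"]) (simp add: open_path_def)

lemma connected_step:
  assumes "connected \<omega> x a" "norm1 (b - a) = 1" "\<omega> {a, b}"
  shows "connected \<omega> x b"
proof -
  obtain xs where "open_path \<omega> xs" "hd xs = x" "last xs = a"
    using assms by (auto simp: connected_def)
  then show ?thesis using assms(2,3) unfolding connected_def
    by (intro exI[of _ "xs @ [b]"]) (auto simp: open_path_def successively_append_iff)
qed

text \<open>A quadrant of the coordinate plane in directions \<open>i\<close> and \<open>j\<close>.
  Natural coordinates parametrise the two half-axes bounding it.\<close>

definition plane_pt :: "'d \<Rightarrow> 'd \<Rightarrow> nat \<Rightarrow> nat \<Rightarrow> int ^ 'd" where
  "plane_pt i j s t = (\<chi> l. if l = i then int s else if l = j then int t else 0)"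

lemma norm1_plane_pt_step1 [simp]: "norm1 (plane_pt i j (Suc s) t - plane_pt i j s t) = 1"
proof -
  have "plane_pt i j (Suc s) t - plane_pt i j s t = unit_vec i"
    by (simp add: plane_pt_def vec_eq_iff unit_vec_nth)
  then show ?thesis by simp
qed

lemma norm1_plane_pt_step2 [simp]:
  assumes "i \<noteq> j"
  shows "norm1 (plane_pt i j s (Suc t) - plane_pt i j s t) = 1"
proof -
  have "plane_pt i j s (Suc t) - plane_pt i j s t = unit_vec j"
    using assms by (simp add: plane_pt_def vec_eq_iff unit_vec_nth)
  then show ?thesis by simp
qed

lemma plane_pt_0: "plane_pt i j 0 0 = 0"
  by (simp add: plane_pt_def vec_eq_iff)

text \<open>If the cluster \<open>C\<close> of the origin is finite, the part of its boundary met by the first axis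
  already carries the whole jump of the indicator of \<open>C\<close>, yet the potential of this part
  does not change along the second axis, nor far away from \<open>C\<close>.\<close>

lemma infinite_open_cluster:
  fixes \<omega> :: "(int ^ 'd::finite) set \<Rightarrow> bool"
  assumes ij: "i \<noteq> j"
  defines "T \<equiv> closed_cluster \<omega> (\<Union>k. {{plane_pt i j k 0, plane_pt i j (Suc k) 0}})"
  assumes avoid: "\<And>l. {plane_pt i j 0 l, plane_pt i j 0 (Suc l)} \<notin> T"
  shows "infinite {y. connected \<omega> 0 y}"
proof
  define C where "C = {y. connected \<omega> 0 y}"
  assume "finite {y. connected \<omega> 0 y}"
  then have finC: "finite C" by (simp add: C_def)
  obtain K where K: "\<And>y. y \<in> C \<Longrightarrow> norm1 y < int K"
  proof -
    obtain K where "\<And>y. y \<in> C \<Longrightarrow> nat (norm1 y) < K"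
      using finite_nat_set_iff_bounded[of "(nat \<circ> norm1) ` C"] finC by auto
    then show ?thesis using that[of K] by (simp add: nat_less_iff norm1_ge_0)
  qed
  \<comment> \<open>The two far sides of the square of side \<open>K\<close> in the quadrant miss
    \<open>C\<close>.\<close>
  have far: "plane_pt i j K t \<notin> C" "plane_pt i j t K \<notin> C" for t
    using abs_nth_le_norm1[of "plane_pt i j K t" i] abs_nth_le_norm1[of "plane_pt i j t K" j] K ij
    by (force simp: plane_pt_def)+
  \<comment> \<open>An open boundary edge would extend the cluster.\<close>
  have bd_closed: "\<not> \<omega> f" if "f \<in> edge_boundary C" for f
    using that connected_step unfolding edge_boundary_def C_def by fastforce
  have stable: "f \<in> T" if "e \<in> T" "f \<in> edge_boundary C" "near e f" for e f
    using that bd_closed[of f] edge_boundary_subset_bonds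
    unfolding T_def by (auto intro: closed_cluster.step)
  obtain g :: "int ^ 'd \<Rightarrow> int" where g: "\<And>a b. norm1 (b - a) = 1 \<Longrightarrow>
       g b - g a = (if {a, b} \<in> T then of_bool (b \<in> C) - of_bool (a \<in> C) else 0)"
    using potential_of_cut_part[of T C] stable by metis
  define P where "P = plane_pt i j"
  have "g (P k 0) - of_bool (P k 0 \<in> C) = g 0 - 1" for k
  proof (induction k)
    case 0
    then show ?case using connected_self by (simp add: P_def plane_pt_0 C_def)
  next
    case (Suc k)
    let ?a = "P k 0" and ?b = "P (Suc k) 0"
    have n: "norm1 (?b - ?a) = 1" by (simp add: P_def)
    show ?case
    proof (cases "{?a, ?b} \<in> edge_boundary C")
      case True
      then have "{?a, ?b} \<in> T"
        using bd_closed[OF True] bondsI[OF n] unfolding T_def P_def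
        by (intro closed_cluster.base) auto
      then show ?thesis using g[OF n] Suc by simp
    next
      case False
      then have "(?a \<in> C) = (?b \<in> C)" using edge_boundary_iff[OF n] by blast
      then show ?thesis using g[OF n] Suc by (auto split: if_splits)
    qed
  qed
  from this[of K] have 1: "g (P K 0) = g 0 - 1" using far by (simp add: P_def)
  \<comment> \<open>From here on, the detour around the square: up the second axis, where
    \<open>avoid\<close> removes all increments, and along the two far sides, where the indicator of
    \<open>C\<close> vanishes. It returns to \<open>P K 0\<close> without any change of
    \<open>g\<close>.\<close>
  have "g (P 0 k) = g 0" for k
  proof (induction k)
    case (Suc k)
    then show ?case
      using g[of "P 0 (Suc k)" "P 0 k"] avoid[of k] ij by (simp add: P_def)
  qed (simp add: P_def plane_pt_0)
  moreover have "g (P K t) = g (P K 0)" for t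
  proof (induction t)
    case (Suc t)
    then show ?case
      using g[of "P K (Suc t)" "P K t"] far ij by (simp add: P_def split: if_splits)
  qed simp
  moreover have "g (P t K) = g (P 0 K)" for t
  proof (induction t)
    case (Suc t)
    then show ?case
      using g[of "P (Suc t) K" "P t K"] far ij by (simp add: P_def split: if_splits)
  qed simp
  ultimately have "g (P K 0) = g 0" by metis
  then show False using 1 by simp
qed

lemma lazy_walk_dist:
  assumes "lazy_walk ws" "v \<in> set ws"
  shows "norm1 (v - hd ws) \<le> int (length ws) - 1"
  using assms
proof (induction ws rule: path_edges.induct)
  case (1 a b xs)
  show ?case
  proof (cases "v = a")
    case False
    then have "norm1 (v - b) \<le> int (length (b # xs)) - 1" using 1 by (auto simp: lazy_walk_def)
    moreover have "norm1 (b - a) \<le> 1" using 1 by (auto simp: lazy_walk_def)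
    moreover have "norm1 (v - a) \<le> norm1 (v - b) + norm1 (b - a)"
      using norm1_add_le[of "v - b" "b - a"] by simp
    ultimately show ?thesis by simp
  qed simp
qed (auto simp: lazy_walk_def)

text \<open>A cluster that joins the \<open>k\<close>-th edge of the first half-axis to the second
  one must reach distance \<open>k\<close>, so its covering walk needs about \<open>k / 4\<close>
  closed bonds. The hypothesis allows at most \<open>k div 8\<close>.\<close>

lemma infinite_open_cluster_if_no_long_closed:
  fixes \<omega> :: "(int ^ 'd::finite) set \<Rightarrow> bool"
  assumes ij: "i \<noteq> j"
    and no: "\<And>k. \<not> closed_along_walk \<omega> (plane_pt i j k 0) (1 + 4 * (k div 8 + 1)) (k div 8 + 1)"
  shows "infinite {y. connected \<omega> 0 y}"
proof (rule infinite_open_cluster[OF ij], rule notI)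
  fix l
  let ?e = "{plane_pt i j 0 l, plane_pt i j 0 (Suc l)}"
  assume "?e \<in> closed_cluster \<omega> (\<Union>k. {{plane_pt i j k 0, plane_pt i j (Suc k) 0}})"
  then obtain k where "?e \<in> closed_cluster \<omega> {{plane_pt i j k 0, plane_pt i j (Suc k) 0}}"
    unfolding closed_cluster_Union by blast
  moreover define \<gamma> where "\<gamma> = [plane_pt i j k 0, plane_pt i j (Suc k) 0]"
  moreover define T where "T = closed_cluster \<omega> (path_edges \<gamma>)"
  ultimately have e: "?e \<in> T" by simp
  have \<gamma>: "lazy_walk \<gamma>" by (simp add: lazy_walk_def \<gamma>_def)
  have T: "finite T" "card T \<le> k div 8"
  proof -
    have "\<not> (infinite T \<or> k div 8 + 1 \<le> card T)"
      using closed_cluster_closed_along_walk[OF \<gamma>, of \<omega> "k div 8 + 1"] no[of k]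
      by (auto simp: \<gamma>_def T_def)
    then show "finite T" "card T \<le> k div 8" by auto
  qed
  obtain S ws where S: "S \<subseteq> T" "card S = card T" "lazy_walk ws" "hd ws = hd \<gamma>"
    "length ws = length \<gamma> + 4 * card T" "S \<subseteq> path_edges ws"
    using closed_cluster_covering_walk[OF \<gamma>, of \<omega> "card T"] unfolding T_def by blast
  have "S = T" using S T by (simp add: card_subset_eq)
  then have "?e \<subseteq> set ws" using e S(6) path_edges_subset_set by blast
  then have "norm1 (plane_pt i j 0 l - plane_pt i j k 0) \<le> int (1 + 4 * card T)"
    using lazy_walk_dist[OF S(3), of "plane_pt i j 0 l"] S by (simp add: \<gamma>_def)
  moreover have "int k \<le> norm1 (plane_pt i j 0 l - plane_pt i j k 0)"
    using abs_nth_le_norm1[of "plane_pt i j 0 l - plane_pt i j k 0" i] by (simp add: plane_pt_def)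
  ultimately have "k \<le> 1 + 4 * card T" by linarith
  \<comment> \<open>\<open>k \<le> 1 + 4 * (k div 8)\<close> forces \<open>k \<le> 2\<close>, hence
    \<open>k div 8 = 0\<close>.\<close>
  then have "card T = 0" using T(2) by linarith
  then show False using T(1) e by simp
qed

section \<open>Measurability of connection events\<close>

lemma open_path_iff:
  "open_path \<omega> xs \<longleftrightarrow> xs \<noteq> [] \<and> successively (\<lambda>a b. norm1 (b - a) = 1) xs \<and> (\<forall>e\<in>path_edges xs. \<omega> e)"
  unfolding open_path_def by (induction xs rule: path_edges.induct) auto

lemma path_edges_subset_bonds:
  "successively (\<lambda>a b. norm1 (b - a) = 1) xs \<Longrightarrow> path_edges xs \<subseteq> bonds"
  by (induction xs rule: path_edges.induct) (auto intro: bondsI)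

text \<open>There are countably many lattice paths, and the openness of each is a finite cylinder
  event.\<close>

lemma connected_measurable:
  "{\<omega> \<in> space (perc p). connected \<omega> (x :: int ^ 'd::finite) y} \<in> sets (perc p)"
proof -
  let ?X = "{xs. xs \<noteq> [] \<and> successively (\<lambda>a b. norm1 (b - a) = 1) xs \<and> hd xs = x \<and> last xs = y}"
  have "{\<omega> \<in> space (perc p). connected \<omega> x y}
      = (\<Union>xs\<in>?X. {\<omega> \<in> space (perc p). \<forall>e\<in>path_edges xs. \<omega> e = True})"
    unfolding connected_def open_path_iff by auto
  also have "\<dots> \<in> sets (perc p)"
    using path_edges_subset_bonds
    by (intro sets.countable_UN' image_subsetI perc_all_eq) auto
  finally show ?thesis .
qed

lemma infinite_cluster_measurable:
  "{\<omega> \<in> space (perc p). infinite {y :: int ^ 'd::finite. connected \<omega> 0 y}} \<in> sets (perc p)"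
proof -
  \<comment> \<open>Norm balls are finite, so infinity of a set of sites becomes a countable
    combination of membership statements.\<close>
  have inf_iff: "infinite X \<longleftrightarrow> (\<forall>n::nat. \<exists>y. int n \<le> norm1 y \<and> y \<in> X)" for X :: "(int ^ 'd) set"
  proof
    assume "infinite X"
    then have "\<not> X \<subseteq> {u. norm1 u \<le> int n}" for n using finite_norm1_ball finite_subset by blast
    then have "\<exists>y. int n < norm1 y \<and> y \<in> X" for n by (auto simp: subset_iff not_le)
    then show "\<forall>n::nat. \<exists>y. int n \<le> norm1 y \<and> y \<in> X" by (meson less_imp_le)
  next
    assume all: "\<forall>n::nat. \<exists>y. int n \<le> norm1 y \<and> y \<in> X"
    show "infinite X"
    proof
      assume "finite X"
      then obtain K where "\<And>y. y \<in> X \<Longrightarrow> nat (norm1 y) < K"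
        using finite_nat_set_iff_bounded[of "(nat \<circ> norm1) ` X"] by auto
      moreover obtain y where "int K \<le> norm1 y" "y \<in> X" using all by blast
      ultimately have "nat (norm1 y) < K" by blast
      then show False using \<open>int K \<le> norm1 y\<close> by linarith
    qed
  qed
  show ?thesis unfolding inf_iff mem_Collect_eq
    by (intro sets.sets_Collect_countable_All sets.sets_Collect_countable_Ex sets.sets_Collect_conj
        sets.sets_Collect_const connected_measurable)
qed

section \<open>Positivity of theta near 1, and p_c < 1\<close>

lemma theta_pos:
  assumes "CARD('d::finite) \<ge> 2"
  obtains p0 where "0 \<le> p0" "p0 < 1" "\<And>p. p0 < p \<Longrightarrow> p \<le> 1 \<Longrightarrow> theta TYPE('d) p > 0"
proof -
  obtain i j :: 'd where ij: "i \<noteq> j"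
    using assms card_le_Suc0_iff_eq[of "UNIV :: 'd set"] by fastforce
  define R where "R = 2 * real (card (unit_steps :: (int ^ 'd) set))"
  have R: "R \<ge> 2" using card_unit_steps_pos[where 'd = 'd] unfolding R_def by linarith
  \<comment> \<open>Makes the sum of \<open>R * s ^ Suc k\<close> over all \<open>k\<close> equal to
    \<open>R / (R + 1)\<close>, which is less than 1.\<close>
  define s where "s = 1 / (R + 2)"
  have s: "0 < s" "s < 1" using R by (auto simp: s_def)
  \<comment> \<open>Above \<open>p0\<close> one has \<open>R ^ 4 * (1 - p) \<le> s ^ 8\<close>. The
    power 8 matches \<open>k div 8\<close>, since
    \<open>8 * (k div 8 + 1) \<ge> k + 1\<close>.\<close>
  define p0 where "p0 = 1 - s ^ 8 / R ^ 4"
  have "s ^ 8 \<le> 1" using s by (simp add: power_le_one)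
  moreover have "1 \<le> R ^ 4" using R by (simp add: one_le_power)
  ultimately have "s ^ 8 \<le> R ^ 4" by linarith
  then have p0: "0 \<le> p0" "p0 < 1" using s R by (simp_all add: p0_def)
  have "theta TYPE('d) p > 0" if p: "p0 < p" "p \<le> 1" for p
  proof -
    interpret prob_space "perc p :: ((int ^ 'd) set \<Rightarrow> bool) measure" by (rule prob_space_perc)
    have p01: "0 \<le> p" "p \<le> 1" using p p0 by auto
    have small: "R ^ 4 * (1 - p) \<le> s ^ 8" using p R by (simp add: p0_def field_simps)
    define A where "A k = {\<omega> \<in> space (perc p). closed_along_walk \<omega> (plane_pt i j k 0)
        (1 + 4 * (k div 8 + 1)) (k div 8 + 1)}" for k
    have A_sets: "A k \<in> sets (perc p)" for k
      unfolding A_def by (rule measure_closed_along_walk(1)[OF p01])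
    have A_le: "prob (A k) \<le> R * s ^ Suc k" for k
    proof -
      let ?m = "k div 8 + 1"
      have "prob (A k) \<le> R ^ (1 + 4 * ?m) * (1 - p) ^ ?m"
        unfolding A_def R_def by (rule measure_closed_along_walk(2)[OF p01])
      also have "\<dots> = R * (R ^ 4 * (1 - p)) ^ ?m"
        by (simp only: power_add[of R 1] power_mult power_mult_distrib power_one_right mult.assoc)
      also have "\<dots> \<le> R * (s ^ 8) ^ ?m"
        using small R p01 by (intro mult_left_mono power_mono) auto
      also have "\<dots> = R * s ^ (8 * ?m)" by (simp only: power_mult)
      also have "\<dots> \<le> R * s ^ Suc k"
        using s R by (intro mult_left_mono power_decreasing) auto
      finally show ?thesis .
    qed
    have sums: "(\<lambda>k. R * s ^ Suc k) sums (R * s * (1 / (1 - s)))"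
      using sums_mult[OF geometric_sums[of s], of "R * s"] s by (simp add: mult.assoc)
    have summ: "summable (\<lambda>k. prob (A k))"
      by (rule summable_comparison_test'[OF sums_summable[OF sums]]) (use A_le in auto)
    have "prob (\<Union>k. A k) \<le> (\<Sum>k. prob (A k))"
      using A_sets summ by (intro finite_measure_subadditive_countably) auto
    also have "\<dots> \<le> R * s * (1 / (1 - s))"
      using suminf_le[OF A_le summ sums_summable[OF sums]] sums_unique[OF sums] by simp
    also have "\<dots> < 1"
    proof -
      have "R * s < 1 - s" using R by (simp add: s_def field_simps)
      then show ?thesis using s by (simp add: divide_less_eq)
    qed
    finally have lt: "prob (\<Union>k. A k) < 1" .
    have "space (perc p) - (\<Union>k. A k) \<subseteq> {\<omega> \<in> space (perc p). infinite {y :: int ^ 'd. connected \<omega> 0 y}}"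
      using infinite_open_cluster_if_no_long_closed[OF ij] by (auto simp: A_def)
    then have "prob (space (perc p) - (\<Union>k. A k)) \<le> theta TYPE('d) p"
      unfolding theta_def by (intro finite_measure_mono infinite_cluster_measurable)
    moreover have "prob (space (perc p) - (\<Union>k. A k)) = 1 - prob (\<Union>k. A k)"
      using A_sets by (intro prob_compl) auto
    ultimately show ?thesis using lt by linarith
  qed
  then show ?thesis using that p0 by blast
qed

text \<open>An infinite cluster needs an open bond at the origin, which has probability 0 here.
  Hence the supremum defining \<open>p_c\<close> is over a nonempty set.\<close>

lemma theta_0: "theta TYPE('d::finite) 0 = 0"
proof -
  interpret prob_space "perc 0 :: ((int ^ 'd) set \<Rightarrow> bool) measure" by (rule prob_space_perc)
  let ?N = "{u :: int ^ 'd. norm1 u = 1}"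
  let ?A = "\<lambda>u. {\<omega> \<in> space (perc 0). \<forall>e\<in>{{0, u}}. \<omega> e = True}"
  have fin: "finite ?N" by (rule finite_subset[OF _ finite_norm1_ball[of 1]]) auto
  have "\<exists>u\<in>?N. \<omega> {0, u}" if inf: "infinite {y. connected \<omega> 0 y}" for \<omega> :: "(int ^ 'd) set \<Rightarrow> bool"
  proof -
    have "\<not> {y. connected \<omega> 0 y} \<subseteq> {0}" using inf finite_subset by blast
    then obtain y xs where y: "y \<noteq> 0" "open_path \<omega> xs" "hd xs = 0" "last xs = y"
      by (auto simp: connected_def)
    then obtain b ys where "xs = 0 # b # ys"
      by (cases xs rule: path_edges.cases) (auto simp: open_path_def)
    then show ?thesis using y(2) by (auto simp: open_path_def)
  qed
  then have sub: "{\<omega> \<in> space (perc 0). infinite {y :: int ^ 'd. connected \<omega> 0 y}} \<subseteq> (\<Union>u\<in>?N. ?A u)"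
    by auto
  have A: "?A u \<in> sets (perc 0)" "prob (?A u) = 0" if "u \<in> ?N" for u
    using perc_all_eq[of "{{0, u}}" 0 True] that bondsI[of u 0] by simp_all
  have "theta TYPE('d) 0 \<le> prob (\<Union>u\<in>?N. ?A u)"
    unfolding theta_def using A fin by (intro finite_measure_mono sub) auto
  also have "\<dots> \<le> (\<Sum>u\<in>?N. prob (?A u))"
    using fin A by (intro finite_measure_subadditive_finite) auto
  also have "\<dots> = 0" using A by simp
  finally show ?thesis unfolding theta_def by (simp add: measure_le_0_iff)
qed

lemma p_c_less_1:
  assumes "CARD('d::finite) \<ge> 2"
  shows "p_c TYPE('d) < 1"
proof -
  obtain p0 where p0: "p0 < 1" "\<And>p. p0 < p \<Longrightarrow> p \<le> 1 \<Longrightarrow> theta TYPE('d) p > 0"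
    using theta_pos[OF assms] by blast
  have "p_c TYPE('d) \<le> p0" unfolding p_c_def
  proof (rule cSup_least)
    show "{p \<in> {0..1}. theta TYPE('d) p = 0} \<noteq> {}"
      using theta_0[where 'd = 'd] by (auto intro!: exI[of _ 0])
    fix p assume "p \<in> {p \<in> {0..1}. theta TYPE('d) p = 0}"
    then show "p \<le> p0" using p0(2)[of p] by force
  qed
  then show ?thesis using p0 by simp
qed

section \<open>Large deviations of the chemical distance\<close>

text \<open>For a finite cluster \<open>T\<close> of a geodesic, the distance bound leaves an excess
  of at least \<alpha> times the norm of \<open>x\<close>, and each bond of \<open>T\<close>
  accounts for at most \<open>2 * q ^ 2\<close> of it, where \<open>q\<close> counts the unit steps;
  \<open>m\<close> is the resulting number of closed bonds.\<close>

lemma large_chem_dist_closed_along_walk: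
  fixes \<omega> :: "(int ^ 'd::finite) set \<Rightarrow> bool" and \<alpha> :: real
  assumes "connected \<omega> 0 x" "chem_dist \<omega> 0 x \<ge> ereal ((1 + \<alpha>) * real_of_int (norm1 x))"
  defines "m \<equiv> nat \<lceil>\<alpha> * real_of_int (norm1 x) / (2 * real (card (unit_steps :: (int ^ 'd) set)) ^ 2)\<rceil>"
  shows "closed_along_walk \<omega> 0 (nat (norm1 x) + 4 * m) m"
proof -
  let ?q = "card (unit_steps :: (int ^ 'd) set)"
  obtain \<gamma> where \<gamma>: "\<gamma> \<noteq> []" "successively (\<lambda>a b. norm1 (b - a) = 1) \<gamma>" "hd \<gamma> = 0" "last \<gamma> = x"
    "length \<gamma> = nat (norm1 x) + 1"
    using path_exists by blast
  have \<gamma>': "lazy_walk \<gamma>"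
    unfolding lazy_walk_def using \<gamma>(1) successively_mono[OF \<gamma>(2)] by simp
  define T where "T = closed_cluster \<omega> (path_edges \<gamma>)"
  have "infinite T \<or> m \<le> card T"
  proof (cases "finite T")
    case True
    \<comment> \<open>Path lengths are integers, so the real lower bound may be rounded up.\<close>
    define N where "N = nat \<lceil>(1 + \<alpha>) * real_of_int (norm1 x)\<rceil>"
    have "N \<le> length xs - 1" if "open_path \<omega> xs" "hd xs = 0" "last xs = x" for xs
    proof -
      have "chem_dist \<omega> 0 x \<le> ereal (real (length xs - 1))"
        unfolding chem_dist_def using that by (intro Inf_lower) auto
      then have "ereal ((1 + \<alpha>) * real_of_int (norm1 x)) \<le> ereal (real (length xs - 1))"
        using assms(2) by (rule order_trans[rotated])
      then show ?thesis unfolding N_def by (simp add: nat_le_iff ceiling_le_iff)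
    qed
    then have "N \<le> (length \<gamma> - 1) + 2 * ?q ^ 2 * card T"
      unfolding T_def using True
      by (intro chem_dist_le_closed_cluster[OF \<gamma>(1-4) assms(1)]) (auto simp: T_def)
    then have "real N \<le> real (nat (norm1 x) + 2 * ?q ^ 2 * card T)"
      using \<gamma>(5) by (simp only: of_nat_le_iff)
    moreover have "(1 + \<alpha>) * real_of_int (norm1 x) \<le> real N" unfolding N_def by linarith
    ultimately have "\<alpha> * real_of_int (norm1 x) \<le> 2 * real ?q ^ 2 * real (card T)"
      using norm1_ge_0[of x] by (simp add: algebra_simps)
    then have "\<alpha> * real_of_int (norm1 x) / (2 * real ?q ^ 2) \<le> real (card T)"
      using card_unit_steps_pos[where 'd = 'd] by (simp add: divide_le_eq mult.commute)
    then show ?thesis unfolding m_def by (simp add: nat_le_iff ceiling_le_iff)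
  qed simp
  then show ?thesis
    using closed_cluster_closed_along_walk[OF \<gamma>', of \<omega> m] \<gamma> by (simp add: T_def)
qed

text \<open>With \<open>R = 2 * q\<close> and \<open>n\<close> the norm of \<open>x\<close>, the
  union bound is \<open>R ^ n * (R ^ 4 * (1 - p)) ^ m\<close>. Since \<open>m\<close> is at least
  \<alpha> n divided by \<open>2 * q ^ 2\<close>, \<open>small\<close> makes the second factor at
  most \<open>exp (- (1 + ln R) * n)\<close>, which beats \<open>R ^ n\<close> and leaves
  \<open>exp (- n)\<close>.\<close>

lemma measure_large_chem_dist:
  fixes \<alpha> :: real and x :: "int ^ 'd::finite"
  defines "q \<equiv> real (card (unit_steps :: (int ^ 'd) set))"
  assumes \<alpha>: "\<alpha> > 0" and p: "0 \<le> p" "p \<le> 1"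
    and small: "(2 * q) ^ 4 * (1 - p) \<le> exp (- (1 + ln (2 * q)) * (2 * q\<^sup>2) / \<alpha>)"
  shows "measure (perc p) {\<omega> \<in> space (perc p). connected \<omega> 0 x \<and>
     chem_dist \<omega> 0 x \<ge> ereal ((1 + \<alpha>) * real_of_int (norm1 x))} \<le> exp (- real_of_int (norm1 x))"
    (is "measure _ ?E \<le> _")
proof -
  interpret prob_space "perc p :: ((int ^ 'd) set \<Rightarrow> bool) measure" by (rule prob_space_perc)
  have q: "q \<ge> 1" using card_unit_steps_pos[where 'd = 'd] unfolding q_def by linarith
  define n where "n = nat (norm1 x)"
  have n: "real_of_int (norm1 x) = real n" using norm1_ge_0[of x] by (simp add: n_def)
  define m where "m = nat \<lceil>\<alpha> * real n / (2 * q\<^sup>2)\<rceil>"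
  have "?E \<subseteq> {\<omega> \<in> space (perc p). closed_along_walk \<omega> 0 (n + 4 * m) m}"
    using large_chem_dist_closed_along_walk[where x = x and \<alpha> = \<alpha>] unfolding m_def q_def n[symmetric] unfolding n_def by auto
  then have "prob ?E \<le> prob {\<omega> \<in> space (perc p). closed_along_walk \<omega> 0 (n + 4 * m) m}"
    by (intro finite_measure_mono measure_closed_along_walk(1) p)
  also have "\<dots> \<le> (2 * q) ^ (n + 4 * m) * (1 - p) ^ m"
    unfolding q_def by (rule measure_closed_along_walk(2)[OF p])
  also have "\<dots> = (2 * q) ^ n * ((2 * q) ^ 4 * (1 - p)) ^ m"
    by (simp only: power_add power_mult power_mult_distrib mult.assoc)
  also have "\<dots> \<le> (2 * q) ^ n * exp (- (1 + ln (2 * q)) * (2 * q\<^sup>2) / \<alpha>) ^ m"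
    using q p small by (intro mult_left_mono power_mono) auto
  also have "\<dots> = exp (real n * ln (2 * q) - (1 + ln (2 * q)) * ((2 * q\<^sup>2) / \<alpha> * real m))"
  proof -
    have "(2 * q) ^ n = exp (real n * ln (2 * q))" using q by (simp add: exp_of_nat_mult)
    moreover have "exp (- (1 + ln (2 * q)) * (2 * q\<^sup>2) / \<alpha>) ^ m
        = exp (- ((1 + ln (2 * q)) * ((2 * q\<^sup>2) / \<alpha> * real m)))"
    proof -
      have "real m * (- a * b / \<alpha>) = - (a * (b / \<alpha> * real m))" for a b by simp
      then show ?thesis unfolding exp_of_nat_mult[symmetric] by (simp only:)
    qed
    ultimately show ?thesis by (simp only: exp_add[symmetric] diff_conv_add_uminus)
  qed
  also have "\<dots> \<le> exp (- real n)"
  proof -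
    have "\<alpha> * real n / (2 * q\<^sup>2) \<le> real m" unfolding m_def by linarith
    then have "real n \<le> (2 * q\<^sup>2) / \<alpha> * real m" using \<alpha> q by (simp add: field_simps)
    moreover have "0 \<le> 1 + ln (2 * q)" using q by simp
    ultimately have "(1 + ln (2 * q)) * real n \<le> (1 + ln (2 * q)) * ((2 * q\<^sup>2) / \<alpha> * real m)"
      by (rule mult_left_mono)
    then show ?thesis by (simp add: algebra_simps)
  qed
  finally show ?thesis using n by simp
qed

theorem theorem1p4:
  assumes "CARD('d::finite) \<ge> 2" and "\<alpha> > (0::real)"
  shows "\<exists>p'. p_c TYPE('d) < p' \<and> p' < 1 \<and>
    (\<forall>p. p' < p \<and> p \<le> 1 \<longrightarrow>
      Limsup (filtercomap (norm1 :: int ^ 'd \<Rightarrow> int) at_top)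
        (\<lambda>x. lnE (measure (perc p)
                 {\<omega> \<in> space (perc p). connected \<omega> 0 x \<and>
                     chem_dist \<omega> 0 x \<ge> ereal ((1 + \<alpha>) * real_of_int (norm1 x))})
              / ereal (real_of_int (norm1 x))) < 0)"
proof -
  define q where "q = real (card (unit_steps :: (int ^ 'd) set))"
  have q: "q \<ge> 1" using card_unit_steps_pos[where 'd = 'd] unfolding q_def by linarith
  define \<epsilon> where "\<epsilon> = exp (- (1 + ln (2 * q)) * (2 * q\<^sup>2) / \<alpha>) / (2 * q) ^ 4"
  have \<epsilon>: "\<epsilon> > 0" using q by (simp add: \<epsilon>_def)
  \<comment> \<open>The terms ensure in turn \<open>p \<ge> 0\<close>, the smallness condition on
    \<open>1 - p\<close>, and a value above \<open>p_c\<close>; the last is the midpoint of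
    \<open>p_c\<close> and 1, so \<open>p'\<close> stays below 1.\<close>
  define p' where "p' = max (max 0 (1 - \<epsilon>)) ((p_c TYPE('d) + 1) / 2)"
  have p': "p_c TYPE('d) < p'" "p' < 1" "0 \<le> p'" "1 - \<epsilon> \<le> p'"
    using p_c_less_1[OF assms(1)] \<epsilon> by (auto simp: p'_def max_def field_simps)
  let ?f = "\<lambda>p x. measure (perc p) {\<omega> \<in> space (perc p). connected \<omega> 0 x \<and>
                     chem_dist \<omega> 0 x \<ge> ereal ((1 + \<alpha>) * real_of_int (norm1 (x :: int ^ 'd)))}"
  have "Limsup (filtercomap (norm1 :: int ^ 'd \<Rightarrow> int) at_top)
        (\<lambda>x. lnE (?f p x) / ereal (real_of_int (norm1 x))) < 0" if p: "p' < p" "p \<le> 1" for p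
  proof -
    have small: "(2 * q) ^ 4 * (1 - p) \<le> exp (- (1 + ln (2 * q)) * (2 * q\<^sup>2) / \<alpha>)"
    proof -
      have "1 - p \<le> \<epsilon>" using p p' by simp
      then show ?thesis using q by (simp add: \<epsilon>_def field_simps)
    qed
    \<comment> \<open>The decay rate 1 is built into \<open>small\<close>, so the bound -1 is
      uniform in \<open>x\<close> and passes to the limsup.\<close>
    have "lnE (?f p x) / ereal (real_of_int (norm1 x)) \<le> ereal (- 1)" if x: "norm1 x \<ge> 1" for x :: "int ^ 'd"
    proof (cases "?f p x = 0")
      \<comment> \<open>Here \<open>lnE\<close> gives minus infinity, which division by a positive
        real preserves.\<close>
      case True
      then show ?thesis using x by (simp add: lnE_def divide_ereal_def)
    next
      case False
      then have pos: "?f p x > 0" by (simp add: zero_less_measure_iff)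
      have "?f p x \<le> exp (- real_of_int (norm1 x))"
        using measure_large_chem_dist[OF assms(2), of p x] p p' small unfolding q_def by simp
      then have "ln (?f p x) \<le> - real_of_int (norm1 x)"
        using pos ln_mono[of "?f p x" "exp (- real_of_int (norm1 x))"] by simp
      then show ?thesis using x False by (simp add: lnE_def divide_le_eq)
    qed
    then have "\<forall>\<^sub>F x in filtercomap (norm1 :: int ^ 'd \<Rightarrow> int) at_top.
        lnE (?f p x) / ereal (real_of_int (norm1 x)) \<le> ereal (- 1)"
      unfolding eventually_filtercomap using eventually_ge_at_top[of "1::int"] by blast
    then have "Limsup (filtercomap (norm1 :: int ^ 'd \<Rightarrow> int) at_top)
        (\<lambda>x. lnE (?f p x) / ereal (real_of_int (norm1 x))) \<le> ereal (- 1)"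
      by (rule Limsup_bounded)
    also have "\<dots> < 0" by simp
    finally show ?thesis .
  qed
  then show ?thesis using p' by blast
qed

end
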